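(* For every complex unital Banach algebra $A$, $$\mathcal J(A)\subseteq\ker s_A.$$ Moreover, the following assertions are equivalent. (i) There are $a,b\in A$ such that $\varepsilon_A(ab)\setminus\{0\}\neq\varepsilon_A(ba)\setminus\{0\}$. (ii) The set $\mathcal J(A)$ contains a non-identity element of $\mathfrak I(A)$.
   Context: For a complex unital Banach algebra $A$, $\operatorname{Inv}(A)$ is the group of invertible elements and $\operatorname{Inv}_0(A)$ is the connected component of $1_A$ in $\operatorname{Inv}(A)$ (equivalently, the set of finite products of exponentials of elements of $A$). The exponential spectrum of $a\in A$ is $\varepsilon_A(a)=\{\lambda\in\mathbb C:\lambda 1_A-a\notin\operatorname{Inv}_0(A)\}$. The index group is $\mathfrak I(A)=\operatorname{Inv}(A)/\operatorname{Inv}_0(A)$; $[u]$ denotes the class of $u\in\operatorname{Inv}(A)$. $M_2(A)$ is the algebra of $2\times2$ matrices over $A$ with any standard Banach-algebra norm (giving the product topology). The first stabilisation map is the group homomorphism $$s_A:\mathfrak I(A)\to\mathfrak I(M_2(A)),\qquad [u]\mapsto\left[\begin{pmatrix}u&0\\0&1\end{pmatrix}\right].$$ The Jacobson part of the index group is the subset $$\mathcal J(A)=\{[1-ab]\in\mathfrak I(A): a,b\in A,\ 1-ab\in\operatorname{Inv}(A),\ 1-ba\in\operatorname{Inv}_0(A)\}.$$ *)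

theory Defs
  imports "HOL-Analysis.Analysis" "HOL-Algebra.Coset"
begin

section \<open>Complex unital Banach algebras\<close>

text \<open>
  The class adds a complex scalar multiplication to the distribution's real Banach algebras.  The
  norm of the unit is not required to be \<open>1\<close>, and the zero algebra is not excluded.
\<close>

class scaleC =
  fixes scaleC :: "complex \<Rightarrow> 'a \<Rightarrow> 'a" (infixr \<open>*\<^sub>C\<close> 75)

class complex_banach_algebra = real_normed_algebra + monoid_mult + banach + scaleC +
  assumes scaleC_add_right: "c *\<^sub>C (x + y) = c *\<^sub>C x + c *\<^sub>C y"
    and scaleC_add_left: "(c + d) *\<^sub>C x = c *\<^sub>C x + d *\<^sub>C x"
    and scaleC_scaleC: "c *\<^sub>C d *\<^sub>C x = (c * d) *\<^sub>C x"
    and scaleC_of_real: "complex_of_real r *\<^sub>C x = r *\<^sub>R x"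
    and mult_scaleC_left: "(c *\<^sub>C x) * y = c *\<^sub>C (x * y)"
    and mult_scaleC_right: "x * (c *\<^sub>C y) = c *\<^sub>C (x * y)"
    and norm_scaleC: "norm (c *\<^sub>C x) = cmod c * norm x"

instantiation complex :: complex_banach_algebra
begin

definition scaleC_complex :: "complex \<Rightarrow> complex \<Rightarrow> complex" where
  "scaleC_complex c x = c * x"

instance
proof
  fix c d x y :: complex and r :: real
  show "c *\<^sub>C (x + y) = c *\<^sub>C x + c *\<^sub>C y" "(c + d) *\<^sub>C x = c *\<^sub>C x + d *\<^sub>C x"
    by (simp_all add: scaleC_complex_def distrib_left distrib_right)
  show "c *\<^sub>C d *\<^sub>C x = (c * d) *\<^sub>C x"
    by (simp add: scaleC_complex_def)
  show "complex_of_real r *\<^sub>C x = r *\<^sub>R x"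
    by (simp add: scaleC_complex_def scaleR_conv_of_real)
  show "(c *\<^sub>C x) * y = c *\<^sub>C (x * y)" "x * (c *\<^sub>C y) = c *\<^sub>C (x * y)"
    by (simp_all add: scaleC_complex_def)
  show "norm (c *\<^sub>C x) = cmod c * norm x"
    by (simp add: scaleC_complex_def norm_mult)
qed

end


section \<open>The Banach algebra of two-by-two matrices\<close>

datatype 'a mat2 = Mat2 (ent11: 'a) (ent12: 'a) (ent21: 'a) (ent22: 'a)

lemma mat2_eq_iff:
  "X = Y \<longleftrightarrow> ent11 X = ent11 Y \<and> ent12 X = ent12 Y \<and> ent21 X = ent21 Y \<and> ent22 X = ent22 Y"
  by (cases X; cases Y) simp

instantiation mat2 :: (complex_banach_algebra) real_normed_algebra
begin

definition "0 = Mat2 0 0 0 0"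

definition "X + Y =
  Mat2 (ent11 X + ent11 Y) (ent12 X + ent12 Y) (ent21 X + ent21 Y) (ent22 X + ent22 Y)"

definition "- X = Mat2 (- ent11 X) (- ent12 X) (- ent21 X) (- ent22 X)"

definition "X - Y =
  Mat2 (ent11 X - ent11 Y) (ent12 X - ent12 Y) (ent21 X - ent21 Y) (ent22 X - ent22 Y)"

definition "X * Y = Mat2
  (ent11 X * ent11 Y + ent12 X * ent21 Y) (ent11 X * ent12 Y + ent12 X * ent22 Y)
  (ent21 X * ent11 Y + ent22 X * ent21 Y) (ent21 X * ent12 Y + ent22 X * ent22 Y)"

definition "r *\<^sub>R X = Mat2 (r *\<^sub>R ent11 X) (r *\<^sub>R ent12 X) (r *\<^sub>R ent21 X) (r *\<^sub>R ent22 X)"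

text \<open>
  Maximum of the row sums; \<open>tendsto_mat2_iff\<close> below shows that it induces the product topology.
\<close>

definition norm_mat2 :: "'a mat2 \<Rightarrow> real" where
  "norm_mat2 X = max (norm (ent11 X) + norm (ent12 X)) (norm (ent21 X) + norm (ent22 X))"

definition dist_mat2 :: "'a mat2 \<Rightarrow> 'a mat2 \<Rightarrow> real" where
  "dist_mat2 X Y = norm (X - Y)"

definition sgn_mat2 :: "'a mat2 \<Rightarrow> 'a mat2" where
  "sgn_mat2 X = inverse (norm X) *\<^sub>R X"

definition uniformity_mat2 :: "('a mat2 \<times> 'a mat2) filter" where
  "uniformity_mat2 = (INF e\<in>{0<..}. principal {(X, Y). dist X Y < e})"

definition open_mat2 :: "'a mat2 set \<Rightarrow> bool" where
  "open_mat2 U \<longleftrightarrow> (\<forall>X\<in>U. eventually (\<lambda>(X', Y). X' = X \<longrightarrow> Y \<in> U) uniformity)"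

lemmas mat2_alg_defs = zero_mat2_def plus_mat2_def uminus_mat2_def minus_mat2_def
  times_mat2_def scaleR_mat2_def

lemma norm_mat2_mult: "norm (X * Y) \<le> norm X * norm Y" for X Y :: "'a mat2"
proof -
  have row: "norm (a * ent11 Y + b * ent21 Y) + norm (a * ent12 Y + b * ent22 Y)
      \<le> (norm a + norm b) * norm Y" for a b :: 'a
  proof -
    have "norm (a * ent11 Y + b * ent21 Y) + norm (a * ent12 Y + b * ent22 Y)
        \<le> (norm a * norm (ent11 Y) + norm b * norm (ent21 Y))
          + (norm a * norm (ent12 Y) + norm b * norm (ent22 Y))"
      by (intro add_mono norm_triangle_le norm_mult_ineq)
    also have "\<dots> = norm a * (norm (ent11 Y) + norm (ent12 Y))
        + norm b * (norm (ent21 Y) + norm (ent22 Y))"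
      by (simp add: algebra_simps)
    also have "\<dots> \<le> norm a * norm Y + norm b * norm Y"
      by (intro add_mono mult_left_mono) (simp_all add: norm_mat2_def)
    finally show ?thesis by (simp add: algebra_simps)
  qed
  have nonneg: "0 \<le> norm Y"
    by (simp add: norm_mat2_def le_max_iff_disj)
  have "(norm (ent11 X) + norm (ent12 X)) * norm Y \<le> norm X * norm Y"
       "(norm (ent21 X) + norm (ent22 X)) * norm Y \<le> norm X * norm Y"
    using nonneg by (auto intro!: mult_right_mono simp: norm_mat2_def)
  with row[of "ent11 X" "ent12 X"] row[of "ent21 X" "ent22 X"] show ?thesis
    by (simp add: times_mat2_def norm_mat2_def[of "Mat2 _ _ _ _"])
qed

lemma norm_mat2_triangle: "norm (X + Y) \<le> norm X + norm Y" for X Y :: "'a mat2"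
  using norm_triangle_ineq[of "ent11 X" "ent11 Y"] norm_triangle_ineq[of "ent12 X" "ent12 Y"]
    norm_triangle_ineq[of "ent21 X" "ent21 Y"] norm_triangle_ineq[of "ent22 X" "ent22 Y"]
  by (simp add: norm_mat2_def plus_mat2_def max_def)

lemma norm_mat2_eq_zero: "norm X = 0 \<longleftrightarrow> X = 0" for X :: "'a mat2"
proof
  assume *: "norm X = 0"
  have "norm (ent11 X) + norm (ent12 X) \<le> 0" "norm (ent21 X) + norm (ent22 X) \<le> 0"
    using * by (auto simp: norm_mat2_def max_def split: if_splits)
  then have "norm (ent11 X) = 0" "norm (ent12 X) = 0" "norm (ent21 X) = 0" "norm (ent22 X) = 0"
    using norm_ge_zero[of "ent11 X"] norm_ge_zero[of "ent12 X"]
      norm_ge_zero[of "ent21 X"] norm_ge_zero[of "ent22 X"] by linarith+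
  then show "X = 0"
    by (simp add: mat2_eq_iff zero_mat2_def)
qed (simp add: norm_mat2_def zero_mat2_def)

lemma norm_mat2_scaleR: "norm (r *\<^sub>R X) = \<bar>r\<bar> * norm X" for X :: "'a mat2"
  by (simp add: norm_mat2_def scaleR_mat2_def max_mult_distrib_left distrib_left)

instance
proof
  show "norm (X + Y) \<le> norm X + norm Y" for X Y :: "'a mat2"
    by (rule norm_mat2_triangle)
  show "norm (r *\<^sub>R X) = \<bar>r\<bar> * norm X" for r and X :: "'a mat2"
    by (rule norm_mat2_scaleR)
  show "norm (X * Y) \<le> norm X * norm Y" for X Y :: "'a mat2"
    by (rule norm_mat2_mult)
next
  fix X Y Z :: "'a mat2" and r s :: real and U :: "'a mat2 set"
  show "X + Y + Z = X + (Y + Z)" "X + Y = Y + X" "0 + X = X" "- X + X = 0" "X - Y = X + - Y"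
    by (simp_all add: mat2_alg_defs add_ac)
  show "r *\<^sub>R (X + Y) = r *\<^sub>R X + r *\<^sub>R Y" "(r + s) *\<^sub>R X = r *\<^sub>R X + s *\<^sub>R X"
    "r *\<^sub>R s *\<^sub>R X = (r * s) *\<^sub>R X" "1 *\<^sub>R X = X"
    by (simp_all add: mat2_alg_defs scaleR_add_right scaleR_add_left)
  show "X * Y * Z = X * (Y * Z)" "(X + Y) * Z = X * Z + Y * Z" "X * (Y + Z) = X * Y + X * Z"
    by (simp_all add: mat2_alg_defs mult.assoc distrib_left distrib_right add_ac)
  show "(r *\<^sub>R X) * Y = r *\<^sub>R (X * Y)" "X * (r *\<^sub>R Y) = r *\<^sub>R (X * Y)"
    by (simp_all add: mat2_alg_defs scaleR_add_right)
  show "norm X = 0 \<longleftrightarrow> X = 0"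
    by (rule norm_mat2_eq_zero)
  show "dist X Y = norm (X - Y)" "sgn X = inverse (norm X) *\<^sub>R X"
    by (rule dist_mat2_def sgn_mat2_def)+
  show "(uniformity :: ('a mat2 \<times> 'a mat2) filter)
      = (INF e\<in>{0<..}. principal {(X, Y). dist X Y < e})"
    by (rule uniformity_mat2_def)
  show "open U \<longleftrightarrow> (\<forall>X\<in>U. eventually (\<lambda>(X', Y). X' = X \<longrightarrow> Y \<in> U) uniformity)"
    by (rule open_mat2_def)
qed

end

lemma norm_ent_diff_le:
  fixes X Y :: "'a::complex_banach_algebra mat2"
  shows "norm (ent11 X - ent11 Y) \<le> norm (X - Y)" "norm (ent12 X - ent12 Y) \<le> norm (X - Y)"
    "norm (ent21 X - ent21 Y) \<le> norm (X - Y)" "norm (ent22 X - ent22 Y) \<le> norm (X - Y)"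
  by (simp_all add: norm_mat2_def minus_mat2_def le_max_iff_disj)

lemma tendsto_mat2_iff:
  fixes L :: "'a::complex_banach_algebra mat2"
  shows "(f \<longlongrightarrow> L) F \<longleftrightarrow>
    ((\<lambda>x. ent11 (f x)) \<longlongrightarrow> ent11 L) F \<and> ((\<lambda>x. ent12 (f x)) \<longlongrightarrow> ent12 L) F \<and>
    ((\<lambda>x. ent21 (f x)) \<longlongrightarrow> ent21 L) F \<and> ((\<lambda>x. ent22 (f x)) \<longlongrightarrow> ent22 L) F"
    (is "?l \<longleftrightarrow> ?r")
proof
  assume ?l
  then have lim: "((\<lambda>x. norm (f x - L)) \<longlongrightarrow> 0) F"
    by (intro tendsto_norm_zero LIM_zero)
  have "((\<lambda>x. p (f x)) \<longlongrightarrow> p L) F"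
    if p: "\<And>A B. norm (p A - p B) \<le> norm (A - B)" for p :: "'a mat2 \<Rightarrow> 'a"
    by (rule LIM_zero_cancel, rule Lim_null_comparison[OF always_eventually lim]) (simp add: p)
  from this[of ent11] this[of ent12] this[of ent21] this[of ent22] show ?r
    by (simp add: norm_ent_diff_le)
next
  assume r: ?r
  then have "((\<lambda>x. norm (ent11 (f x) - ent11 L)) \<longlongrightarrow> 0) F"
    "((\<lambda>x. norm (ent12 (f x) - ent12 L)) \<longlongrightarrow> 0) F"
    "((\<lambda>x. norm (ent21 (f x) - ent21 L)) \<longlongrightarrow> 0) F"
    "((\<lambda>x. norm (ent22 (f x) - ent22 L)) \<longlongrightarrow> 0) F"
    by (simp_all add: tendsto_norm_zero_iff LIM_zero_iff)
  from tendsto_max[OF tendsto_add[OF this(1,2)] tendsto_add[OF this(3,4)]]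
  have "((\<lambda>x. norm (f x - L)) \<longlongrightarrow> 0) F"
    by (simp add: norm_mat2_def minus_mat2_def)
  then show ?l
    by (rule LIM_zero_cancel[OF tendsto_norm_zero_cancel])
qed

instantiation mat2 :: (complex_banach_algebra) complex_banach_algebra
begin

definition "1 = Mat2 1 0 0 1"

definition "c *\<^sub>C X = Mat2 (c *\<^sub>C ent11 X) (c *\<^sub>C ent12 X) (c *\<^sub>C ent21 X) (c *\<^sub>C ent22 X)"

instance
proof
  fix X :: "nat \<Rightarrow> 'a mat2"
  assume X: "Cauchy X"
  have lim: "\<exists>l. (\<lambda>n. p (X n)) \<longlonglongrightarrow> l"
    if p: "\<And>A B. norm (p A - p B) \<le> norm (A - B)" for p :: "'a mat2 \<Rightarrow> 'a"
  proof -
    have "Cauchy (\<lambda>n. p (X n))"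
      using X p unfolding Cauchy_def dist_norm by (meson order_le_less_trans)
    then show ?thesis
      using Cauchy_convergent convergent_def by blast
  qed
  obtain a where "(\<lambda>n. ent11 (X n)) \<longlonglongrightarrow> a"
    using lim[of ent11, OF norm_ent_diff_le(1)] by blast
  moreover obtain b where "(\<lambda>n. ent12 (X n)) \<longlonglongrightarrow> b"
    using lim[of ent12, OF norm_ent_diff_le(2)] by blast
  moreover obtain c where "(\<lambda>n. ent21 (X n)) \<longlonglongrightarrow> c"
    using lim[of ent21, OF norm_ent_diff_le(3)] by blast
  moreover obtain d where "(\<lambda>n. ent22 (X n)) \<longlonglongrightarrow> d"
    using lim[of ent22, OF norm_ent_diff_le(4)] by blast
  ultimately have "X \<longlonglongrightarrow> Mat2 a b c d"
    by (simp add: tendsto_mat2_iff)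
  then show "convergent X"
    by (rule convergentI)
next
  show "norm (c *\<^sub>C X) = cmod c * norm X" for c and X :: "'a mat2"
    by (simp add: norm_mat2_def scaleC_mat2_def norm_scaleC max_mult_distrib_left distrib_left)
next
  fix X Y :: "'a mat2" and c d :: complex and r :: real
  show "1 * X = X" "X * 1 = X"
    by (simp_all add: one_mat2_def times_mat2_def)
  show "c *\<^sub>C (X + Y) = c *\<^sub>C X + c *\<^sub>C Y" "(c + d) *\<^sub>C X = c *\<^sub>C X + d *\<^sub>C X"
    by (simp_all add: scaleC_mat2_def plus_mat2_def scaleC_add_right scaleC_add_left)
  show "c *\<^sub>C d *\<^sub>C X = (c * d) *\<^sub>C X" "complex_of_real r *\<^sub>C X = r *\<^sub>R X"
    by (simp_all add: scaleC_mat2_def scaleR_mat2_def scaleC_scaleC scaleC_of_real)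
  show "(c *\<^sub>C X) * Y = c *\<^sub>C (X * Y)" "X * (c *\<^sub>C Y) = c *\<^sub>C (X * Y)"
    by (simp_all add: scaleC_mat2_def times_mat2_def scaleC_add_right mult_scaleC_left
        mult_scaleC_right)
qed

end


section \<open>Invertible elements and the index group\<close>

definition mult_monoid :: "'a::complex_banach_algebra monoid" where
  "mult_monoid = \<lparr>carrier = UNIV, mult = (*), one = 1\<rparr>"

definition Inv_group :: "'a::complex_banach_algebra monoid" where
  "Inv_group = units_of mult_monoid"

definition Inv :: "'a::complex_banach_algebra set" where
  "Inv = carrier Inv_group"

definition Inv0 :: "'a::complex_banach_algebra set" where
  "Inv0 = connected_component_set Inv 1"

definition exp_spectrum :: "'a::complex_banach_algebra \<Rightarrow> complex set" where
  "exp_spectrum a = {c. c *\<^sub>C 1 - a \<notin> Inv0}"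

definition index_group :: "'a::complex_banach_algebra set monoid" where
  "index_group = Inv_group Mod Inv0"

definition index_class :: "'a::complex_banach_algebra \<Rightarrow> 'a set" where
  "index_class u = Inv0 #>\<^bsub>Inv_group\<^esub> u"

lemma mem_Inv_iff: "u \<in> Inv \<longleftrightarrow> (\<exists>v. v * u = 1 \<and> u * v = 1)"
  by (auto simp: Inv_def Inv_group_def units_of_carrier Units_def mult_monoid_def)

lemma Inv_group_simps [simp]:
  "carrier Inv_group = Inv" "mult Inv_group = (*)" "one Inv_group = 1"
  by (simp_all add: Inv_def Inv_group_def units_of_mult units_of_one mult_monoid_def)

lemma group_Inv_group: "group Inv_group"
proof -
  have "monoid mult_monoid"
    by unfold_locales (auto simp: mult_monoid_def mult.assoc)
  then show ?thesis
    unfolding Inv_group_def by (rule monoid.units_group)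
qed

lemma one_in_Inv0: "1 \<in> Inv0"
  by (auto simp: Inv0_def mem_Inv_iff)

lemma Inv0_subset_Inv: "Inv0 \<subseteq> Inv"
  by (simp add: Inv0_def connected_component_subset)

lemma Inv0_maximal: "connected T \<Longrightarrow> 1 \<in> T \<Longrightarrow> T \<subseteq> Inv \<Longrightarrow> T \<subseteq> Inv0"
  unfolding Inv0_def by (rule connected_component_maximal)

text \<open>
  A continuous map that preserves invertibility and sends some element of the identity component
  into the identity component preserves the identity component.
\<close>

lemma image_Inv0_subset:
  fixes f :: "'a::complex_banach_algebra \<Rightarrow> 'b::complex_banach_algebra"
  assumes "continuous_on UNIV f" "\<And>x. x \<in> Inv \<Longrightarrow> f x \<in> Inv" "w \<in> Inv0" "f w \<in> Inv0"
  shows "f ` Inv0 \<subseteq> Inv0"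
proof -
  have "connected (f ` Inv0)"
    using assms(1) continuous_on_subset unfolding Inv0_def
    by (blast intro: connected_continuous_image connected_connected_component)
  moreover have "connected (Inv0 :: 'b set)"
    unfolding Inv0_def by (rule connected_connected_component)
  ultimately have "connected (f ` Inv0 \<union> Inv0)"
    using assms(3,4) by (intro connected_Un) auto
  then have "f ` Inv0 \<union> Inv0 \<subseteq> Inv0"
    using assms(2) Inv0_subset_Inv[where 'a = 'a] Inv0_subset_Inv[where 'a = 'b] one_in_Inv0
    by (intro Inv0_maximal) auto
  then show ?thesis by blast
qed

lemma Inv_mult: "u \<in> Inv \<Longrightarrow> v \<in> Inv \<Longrightarrow> u * v \<in> Inv"
  using monoid.m_closed[OF group.is_monoid[OF group_Inv_group]] by simp

lemma Inv0_normal: "Inv0 \<lhd> (Inv_group :: 'a::complex_banach_algebra monoid)"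
proof -
  interpret group "Inv_group :: 'a monoid" by (rule group_Inv_group)
  have inv: "m_inv Inv_group u \<in> Inv" "m_inv Inv_group u * u = 1" "u * m_inv Inv_group u = 1"
    if "u \<in> Inv" for u :: 'a
    using that inv_closed[of u] l_inv[of u] r_inv[of u] by simp_all
  have "(\<lambda>x. u * x) ` Inv0 \<subseteq> Inv0" if "u \<in> Inv0" for u :: 'a
  proof (rule image_Inv0_subset[OF _ _ one_in_Inv0])
    show "continuous_on UNIV (\<lambda>x. u * x)" by (intro continuous_intros)
  qed (use that Inv0_subset_Inv in \<open>auto intro: Inv_mult\<close>)
  then have mult: "u * v \<in> Inv0" if "u \<in> Inv0" "v \<in> Inv0" for u v :: 'a
    using that by blast
  have minv: "m_inv Inv_group u \<in> Inv0" if "u \<in> Inv0" for u :: 'a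
  proof -
    have u: "u \<in> Inv" using that Inv0_subset_Inv by blast
    have "(\<lambda>x. m_inv Inv_group u * x) ` Inv0 \<subseteq> Inv0"
    proof (rule image_Inv0_subset[OF _ _ that])
      show "continuous_on UNIV (\<lambda>x. m_inv Inv_group u * x)" by (intro continuous_intros)
    qed (simp_all add: inv u Inv_mult one_in_Inv0)
    then have "m_inv Inv_group u * 1 \<in> Inv0" using one_in_Inv0 by blast
    then show ?thesis by simp
  qed
  have conj: "u * h * m_inv Inv_group u \<in> Inv0" if u: "u \<in> Inv" and h: "h \<in> Inv0" for u h :: 'a
  proof -
    have "(\<lambda>x. u * x * m_inv Inv_group u) ` Inv0 \<subseteq> Inv0"
    proof (rule image_Inv0_subset[OF _ _ one_in_Inv0])
      show "continuous_on UNIV (\<lambda>x. u * x * m_inv Inv_group u)" by (intro continuous_intros)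
    qed (simp_all add: inv u Inv_mult one_in_Inv0)
    then show ?thesis using h by blast
  qed
  have "subgroup Inv0 (Inv_group :: 'a monoid)"
    by (rule subgroup.intro) (simp_all add: Inv0_subset_Inv one_in_Inv0 mult minv)
  then show ?thesis
    by (simp add: normal_inv_iff conj)
qed

lemma group_index_group: "group index_group"
  unfolding index_group_def by (rule normal.factorgroup_is_group[OF Inv0_normal])

text \<open>
  \<open>stabilisation_index_class\<close> shows that the class is independent of the representative, so that
  \<open>the_elem\<close> is applied to a singleton; \<open>stabilisation_hom\<close> that the map is a homomorphism.
\<close>

definition stabilisation :: "'a::complex_banach_algebra set \<Rightarrow> 'a mat2 set" where
  "stabilisation C = the_elem ((\<lambda>u. index_class (Mat2 u 0 0 1)) ` C)"

definition Jacobson_part :: "'a::complex_banach_algebra set set" where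
  "Jacobson_part = {index_class (1 - a * b) | a b. 1 - a * b \<in> Inv \<and> 1 - b * a \<in> Inv0}"

lemma Mat2_mult_diag: "Mat2 u 0 0 1 * Mat2 v 0 0 1 = Mat2 (u * v) 0 0 1"
  by (simp add: times_mat2_def)

lemma Mat2_diag_Inv:
  assumes "u \<in> Inv"
  shows "Mat2 u 0 0 1 \<in> Inv"
proof -
  obtain v where "v * u = 1" "u * v = 1" using assms by (auto simp: mem_Inv_iff)
  then have "Mat2 v 0 0 1 * Mat2 u 0 0 1 = 1" "Mat2 u 0 0 1 * Mat2 v 0 0 1 = 1"
    by (simp_all add: Mat2_mult_diag one_mat2_def)
  then show ?thesis by (auto simp: mem_Inv_iff)
qed

lemma Mat2_diag_Inv0:
  fixes u :: "'a::complex_banach_algebra"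
  assumes "u \<in> Inv0"
  shows "Mat2 u 0 0 1 \<in> Inv0"
proof -
  have "(\<lambda>u::'a. Mat2 u 0 0 1) ` Inv0 \<subseteq> Inv0"
  proof (rule image_Inv0_subset[OF _ _ one_in_Inv0])
    show "continuous_on UNIV (\<lambda>u::'a. Mat2 u 0 0 1)"
      unfolding continuous_on_def tendsto_mat2_iff mat2.sel by (intro ballI conjI tendsto_intros)
    show "Mat2 x 0 0 1 \<in> Inv" if "x \<in> Inv" for x :: 'a
      using that by (rule Mat2_diag_Inv)
    show "Mat2 (1::'a) 0 0 1 \<in> Inv0"
      using one_in_Inv0[where 'a = "'a mat2"] unfolding one_mat2_def .
  qed
  then show ?thesis using assms by blast
qed

lemma stabilisation_index_class:
  assumes "u \<in> Inv"
  shows "stabilisation (index_class u) = index_class (Mat2 u 0 0 1)"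
proof -
  have "index_class (Mat2 w 0 0 1) = index_class (Mat2 u 0 0 1)" if w: "w \<in> index_class u" for w
  proof -
    obtain h where h: "h \<in> Inv0" "w = h * u"
      using w by (auto simp: index_class_def r_coset_def)
    have "Mat2 w 0 0 1 \<in> Inv0 #>\<^bsub>Inv_group\<^esub> Mat2 u 0 0 1"
      using h Mat2_diag_Inv0[OF h(1)] by (auto simp: r_coset_def simp flip: Mat2_mult_diag)
    then show ?thesis
      unfolding index_class_def
      by (rule group.repr_independence[OF group_Inv_group _ _ normal_imp_subgroup[OF Inv0_normal],
            symmetric]) (simp_all add: Mat2_diag_Inv[OF assms])
  qed
  moreover have "u \<in> index_class u"
    unfolding index_class_def
    by (rule group.rcos_self[OF group_Inv_group _ normal_imp_subgroup[OF Inv0_normal]])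
      (simp add: assms)
  ultimately show ?thesis
    unfolding stabilisation_def by (intro the_elem_image_unique) blast+
qed

lemma stabilisation_hom: "stabilisation \<in> hom index_group index_group"
proof -
  have carrier: "carrier index_group = index_class ` Inv"
    by (auto simp: index_group_def FactGroup_def RCOSETS_def index_class_def)
  have mult: "index_class u \<otimes>\<^bsub>index_group\<^esub> index_class v = index_class (u * v)"
    if "u \<in> Inv" "v \<in> Inv" for u v :: "'b::complex_banach_algebra"
    using normal.rcos_sum[OF Inv0_normal] that
    by (simp add: index_group_def FactGroup_def index_class_def)
  show ?thesis
    by (auto simp: hom_def carrier mult stabilisation_index_class Mat2_diag_Inv Inv_mult
        Mat2_mult_diag)
qed

end

theory Submission
  imports Defs
begin

text \<open>
  Both parts rest on classical facts about the pair \<open>1 - a * b\<close>, \<open>1 - b * a\<close>.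

  For the inclusion, the matrix with unit diagonal and off-diagonal entries \<open>a\<close>, \<open>b\<close> can be
  eliminated in two ways: \<open>U(a) diag(1 - a * b, 1) L(b) = L(b) diag(1, 1 - b * a) U(a)\<close>, where
  \<open>U(a)\<close> and \<open>L(b)\<close> are the upper and lower elementary matrices.  Elementary matrices are joined
  to the unit by shrinking their off-diagonal entry, so \<open>diag(1 - a * b, 1)\<close> and
  \<open>diag(1, 1 - b * a)\<close> have the same index class.  This class is trivial as soon as \<open>1 - b * a\<close>
  lies in the identity component (\<open>Mat2_Jacobson_Inv0\<close>).

  For the equivalence, the nonzero scalars form a connected set of invertible elements, so the
  identity component is stable under multiplication by them (\<open>scaleC_Inv0_iff\<close>).  Hence a nonzero
  point \<open>c\<close> that separates the exponential spectra of \<open>a * b\<close> and \<open>b * a\<close> can be moved to \<open>1\<close> by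
  replacing \<open>a\<close> with \<open>inverse c *\<^sub>C a\<close>.  The pair then has exactly one of \<open>1 - a * b\<close>, \<open>1 - b * a\<close>
  in the identity component, and by Jacobson's lemma (\<open>Jacobson_Inv\<close>) the other one is still
  invertible: this is a non-identity element of the Jacobson part.
\<close>

lemma Inv0_mult: "u \<in> Inv0 \<Longrightarrow> v \<in> Inv0 \<Longrightarrow> u * v \<in> Inv0"
  using subgroup.m_closed[OF normal_imp_subgroup[OF Inv0_normal]] by simp

lemma index_class_eq_one_iff:
  assumes "u \<in> Inv"
  shows "index_class u = \<one>\<^bsub>index_group\<^esub> \<longleftrightarrow> u \<in> Inv0"
proof -
  have sub: "subgroup Inv0 (Inv_group :: 'a monoid)"
    by (rule normal_imp_subgroup[OF Inv0_normal])
  have "index_class u = Inv0 \<longleftrightarrow> u \<in> Inv0"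
    unfolding index_class_def
    using group.coset_join1[OF group_Inv_group, of Inv0 u]
      group.coset_join2[OF group_Inv_group, of u Inv0]
      subgroup.subset[OF sub] assms sub by auto
  then show ?thesis
    by (simp add: index_group_def FactGroup_def)
qed

text \<open>
  Jacobson's lemma.  The inverse is suggested by the geometric series:
  \<open>1 + ab + abab + \<dots> = 1 + a (1 + ba + \<dots>) b\<close>.
\<close>

lemma Jacobson_Inv:
  fixes a b :: "'a::complex_banach_algebra"
  assumes "1 - b * a \<in> Inv"
  shows "1 - a * b \<in> Inv"
proof -
  obtain v where v: "v * (1 - b * a) = 1" "(1 - b * a) * v = 1"
    using assms by (auto simp: mem_Inv_iff)
  have "(1 + a * v * b) * (1 - a * b) = 1 - a * b + a * (v * (1 - b * a)) * b"
    by (simp add: algebra_simps)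
  moreover have "(1 - a * b) * (1 + a * v * b) = 1 - a * b + a * ((1 - b * a) * v) * b"
    by (simp add: algebra_simps)
  ultimately show ?thesis
    unfolding mem_Inv_iff v by (intro exI[of _ "1 + a * v * b"]) simp
qed


section \<open>Scalar multiples in the identity component\<close>

lemma scaleC_one: "1 *\<^sub>C x = (x :: 'a::complex_banach_algebra)"
  using scaleC_of_real[of 1 x] by simp

lemma bounded_linear_scaleC_left: "bounded_linear (\<lambda>c. c *\<^sub>C (x :: 'a::complex_banach_algebra))"
proof (rule bounded_linear_intro)
  show "(r *\<^sub>R c) *\<^sub>C x = r *\<^sub>R c *\<^sub>C x" for r c
    by (simp add: scaleR_conv_of_real flip: scaleC_scaleC scaleC_of_real)
  show "norm (c *\<^sub>C x) \<le> norm c * norm x" for c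
    by (simp add: norm_scaleC)
qed (simp add: scaleC_add_left)

lemma scaleC_one_Inv0:
  assumes "c \<noteq> 0"
  shows "c *\<^sub>C 1 \<in> (Inv0 :: 'a::complex_banach_algebra set)"
proof -
  have conn: "connected (- {0 :: complex})"
    by (rule connected_punctured_universe) simp
  have "connected ((\<lambda>c. c *\<^sub>C (1::'a)) ` (- {0}))"
    by (intro connected_continuous_image conn linear_continuous_on bounded_linear_scaleC_left)
  moreover have "d *\<^sub>C (1::'a) \<in> Inv" if "d \<noteq> 0" for d
    unfolding mem_Inv_iff using that
    by (intro exI[of _ "inverse d *\<^sub>C 1"])
      (simp add: mult_scaleC_left scaleC_scaleC scaleC_one)
  moreover have "1 \<in> (\<lambda>c. c *\<^sub>C (1::'a)) ` (- {0})"
    by (rule image_eqI[of _ _ 1]) (simp_all add: scaleC_one)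
  ultimately have "(\<lambda>c. c *\<^sub>C (1::'a)) ` (- {0}) \<subseteq> Inv0"
    by (intro Inv0_maximal) auto
  then show ?thesis
    using assms by auto
qed

lemma scaleC_Inv0_iff:
  fixes x :: "'a::complex_banach_algebra"
  assumes "c \<noteq> 0"
  shows "c *\<^sub>C x \<in> Inv0 \<longleftrightarrow> x \<in> Inv0"
proof -
  have imp: "d *\<^sub>C y \<in> Inv0" if "d \<noteq> 0" "y \<in> Inv0" for d and y :: 'a
    using Inv0_mult[OF scaleC_one_Inv0[OF that(1)] that(2)] by (simp add: mult_scaleC_left)
  have "inverse c *\<^sub>C c *\<^sub>C x = x"
    using assms by (simp add: scaleC_scaleC scaleC_one)
  then show ?thesis
    using imp[of c x] imp[of "inverse c" "c *\<^sub>C x"] assms by auto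
qed

text \<open>
  Normalises a nonzero point of the spectrum to \<open>1\<close>; the factor \<open>inverse c\<close> may be attached to
  either element of a product, so the same rescaling serves \<open>a * b\<close> and \<open>b * a\<close>.
\<close>

lemma mem_exp_spectrum_iff:
  assumes "c \<noteq> 0"
  shows "c \<in> exp_spectrum x \<longleftrightarrow> 1 - inverse c *\<^sub>C x \<notin> Inv0"
proof -
  have "c *\<^sub>C 1 - x = c *\<^sub>C (1 - inverse c *\<^sub>C x)"
    using scaleC_add_right[of c "1 - inverse c *\<^sub>C x" "inverse c *\<^sub>C x"] assms
    by (simp add: scaleC_scaleC scaleC_one)
  then show ?thesis
    by (simp add: exp_spectrum_def scaleC_Inv0_iff[OF assms])
qed


section \<open>Elementary matrices and the stabilised Jacobson part\<close>

lemma Mat2_upper_Inv0: "Mat2 1 a 0 1 \<in> (Inv0 :: 'a::complex_banach_algebra mat2 set)"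
proof -
  have "continuous_on UNIV (\<lambda>x::'a. Mat2 1 x 0 1)"
    unfolding continuous_on_def tendsto_mat2_iff mat2.sel by (intro ballI conjI tendsto_intros)
  then have "connected (range (\<lambda>x::'a. Mat2 1 x 0 1))"
    by (intro connected_continuous_image connected_UNIV)
  moreover have "Mat2 1 x 0 1 \<in> Inv" for x :: 'a
    unfolding mem_Inv_iff
    by (intro exI[of _ "Mat2 1 (- x) 0 1"]) (simp add: times_mat2_def one_mat2_def)
  ultimately have "range (\<lambda>x::'a. Mat2 1 x 0 1) \<subseteq> Inv0"
    by (intro Inv0_maximal) (auto simp: one_mat2_def)
  then show ?thesis by auto
qed

text \<open>
  Exchanging the two coordinates is a continuous algebra automorphism, whereas transposition
  reverses products only over a commutative algebra.  It carries upper to lower elementary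
  matrices and exchanges the two diagonal embeddings of the algebra.
\<close>

lemma Mat2_swap_Inv0:
  fixes p q r s :: "'a::complex_banach_algebra"
  assumes "Mat2 p q r s \<in> Inv0"
  shows "Mat2 s r q p \<in> Inv0"
proof -
  let ?swap = "\<lambda>X::'a mat2. Mat2 (ent22 X) (ent21 X) (ent12 X) (ent11 X)"
  have mult: "?swap X * ?swap Y = ?swap (X * Y)" for X Y
    by (simp add: times_mat2_def add.commute)
  have one: "?swap 1 = 1"
    by (simp add: one_mat2_def)
  have "?swap ` Inv0 \<subseteq> Inv0"
  proof (rule image_Inv0_subset[OF _ _ one_in_Inv0])
    \<comment> \<open>Through \<open>tendsto_mat2_iff\<close>, convergence of the identity says that all entries are continuous.\<close>
    have "(id \<longlongrightarrow> X) (at X)" for X :: "'a mat2"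
      by (simp add: id_def)
    then show "continuous_on UNIV ?swap"
      by (simp add: continuous_on_def tendsto_mat2_iff)
    show "?swap X \<in> Inv" if X: "X \<in> Inv" for X
    proof -
      obtain Y where "Y * X = 1" "X * Y = 1"
        using X by (auto simp: mem_Inv_iff)
      then show ?thesis
        unfolding mem_Inv_iff by (intro exI[of _ "?swap Y"]) (simp only: mult one simp_thms)
    qed
  qed (simp add: one one_in_Inv0)
  then show ?thesis
    using assms by force
qed

text \<open>
  The two factorisations of the matrix with rows \<open>(1, a)\<close>, \<open>(b, 1)\<close>, solved for the diagonal
  factor \<open>diag(1 - a * b, 1)\<close>.
\<close>

lemma Mat2_Jacobson_Inv0:
  fixes a b :: "'a::complex_banach_algebra"
  assumes "1 - b * a \<in> Inv0"
  shows "Mat2 (1 - a * b) 0 0 1 \<in> Inv0"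
proof -
  have elim: "Mat2 1 (- a) 0 1 * Mat2 1 0 b 1 * Mat2 1 0 0 (1 - b * a) * Mat2 1 a 0 1
        * Mat2 1 0 (- b) 1
      = Mat2 (1 - a * b) 0 0 1"
    by (simp add: times_mat2_def algebra_simps)
  have diag: "Mat2 1 0 0 (1 - b * a) \<in> Inv0"
    by (rule Mat2_swap_Inv0[OF Mat2_diag_Inv0[OF assms]])
  have "Mat2 1 0 y 1 \<in> Inv0" for y :: 'a
    by (rule Mat2_swap_Inv0[OF Mat2_upper_Inv0])
  then have "Mat2 1 (- a) 0 1 * Mat2 1 0 b 1 * Mat2 1 0 0 (1 - b * a) * Mat2 1 a 0 1
      * Mat2 1 0 (- b) 1 \<in> Inv0"
    using diag by (intro Inv0_mult Mat2_upper_Inv0)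
  with elim show ?thesis by simp
qed

lemma Jacobson_part_subset_kernel:
  "(Jacobson_part :: 'a::complex_banach_algebra set set)
    \<subseteq> kernel index_group index_group stabilisation"
proof
  fix C :: "'a set"
  assume "C \<in> Jacobson_part"
  then obtain a b :: 'a where C: "C = index_class (1 - a * b)"
    and ab: "1 - a * b \<in> Inv" and ba: "1 - b * a \<in> Inv0"
    by (auto simp: Jacobson_part_def)
  have "C \<in> carrier index_group"
    using ab by (auto simp: C index_group_def FactGroup_def RCOSETS_def index_class_def)
  moreover have "stabilisation C = \<one>\<^bsub>index_group\<^esub>"
    using ab ba
    by (simp add: C stabilisation_index_class index_class_eq_one_iff Mat2_diag_Inv
        Mat2_Jacobson_Inv0)
  ultimately show "C \<in> kernel index_group index_group stabilisation"
    by (simp add: kernel_def)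
qed


section \<open>Exponential spectra and the Jacobson part\<close>

lemma Jacobson_part_nontrivial_iff:
  "(\<exists>C \<in> (Jacobson_part :: 'a::complex_banach_algebra set set). C \<noteq> \<one>\<^bsub>index_group\<^esub>) \<longleftrightarrow>
    (\<exists>a b :: 'a. 1 - b * a \<in> Inv0 \<and> 1 - a * b \<notin> Inv0)" (is "?l \<longleftrightarrow> ?r")
proof
  assume ?l
  then obtain a b :: 'a where "1 - a * b \<in> Inv" "1 - b * a \<in> Inv0"
    "index_class (1 - a * b) \<noteq> \<one>\<^bsub>index_group\<^esub>"
    by (auto simp: Jacobson_part_def)
  then show ?r
    by (auto simp: index_class_eq_one_iff)
next
  assume ?r
  then obtain a b :: 'a where ba: "1 - b * a \<in> Inv0" and ab: "1 - a * b \<notin> Inv0"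
    by auto
  have inv: "1 - a * b \<in> Inv"
    using ba Inv0_subset_Inv by (blast intro: Jacobson_Inv)
  then have "index_class (1 - a * b) \<in> Jacobson_part"
    using ba by (auto simp: Jacobson_part_def)
  moreover have "index_class (1 - a * b) \<noteq> \<one>\<^bsub>index_group\<^esub>"
    using ab by (simp add: index_class_eq_one_iff[OF inv])
  ultimately show ?l ..
qed

lemma exp_spectrum_commute_iff:
  "(\<forall>a b :: 'a::complex_banach_algebra. exp_spectrum (a * b) - {0} = exp_spectrum (b * a) - {0}) \<longleftrightarrow>
    (\<forall>a b :: 'a. 1 - b * a \<in> Inv0 \<longrightarrow> 1 - a * b \<in> Inv0)"
proof (intro iffI allI impI)
  fix a b :: 'a
  assume eq: "\<forall>a b :: 'a. exp_spectrum (a * b) - {0} = exp_spectrum (b * a) - {0}"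
    and ba: "1 - b * a \<in> Inv0"
  have "1 \<notin> exp_spectrum (b * a) - {0}"
    using ba by (simp add: exp_spectrum_def scaleC_one)
  then have "1 \<notin> exp_spectrum (a * b) - {0}"
    by (subst eq[rule_format, of a b])
  then show "1 - a * b \<in> Inv0"
    by (simp add: exp_spectrum_def scaleC_one)
next
  fix a b :: 'a
  assume imp: "\<forall>a b :: 'a. 1 - b * a \<in> Inv0 \<longrightarrow> 1 - a * b \<in> Inv0"
  have "c \<in> exp_spectrum (a * b) \<longleftrightarrow> c \<in> exp_spectrum (b * a)" if c: "c \<noteq> 0" for c
  proof -
    have "1 - (inverse c *\<^sub>C a) * b \<in> Inv0 \<longleftrightarrow> 1 - b * (inverse c *\<^sub>C a) \<in> Inv0"
      using imp by blast
    then show ?thesis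
      by (simp add: mem_exp_spectrum_iff[OF c] mult_scaleC_left mult_scaleC_right)
  qed
  then show "exp_spectrum (a * b) - {0} = exp_spectrum (b * a) - {0}"
    by blast
qed

theorem proposition7p3:
  shows "(Jacobson_part :: 'a::complex_banach_algebra set set)
      \<subseteq> kernel index_group index_group stabilisation \<and>
    ((\<exists>a b :: 'a. exp_spectrum (a * b) - {0} \<noteq> exp_spectrum (b * a) - {0}) \<longleftrightarrow>
     (\<exists>C \<in> (Jacobson_part :: 'a set set). C \<noteq> \<one>\<^bsub>index_group\<^esub>))"
  using Jacobson_part_subset_kernel exp_spectrum_commute_iff[where 'a = 'a]
  unfolding Jacobson_part_nontrivial_iff by blast

end
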